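(* Let $p\ge3$ be a prime and, for real $n>0$, let $$ \widetilde{r}_{\mathrm{Pl}}(n,p):=\frac{3p-4}{8(p-1)}\,n+\log_p n+\log_p\!\Bigl(\frac{p^3}{8}\Bigr). $$ Then the following hold: 1. $\widetilde{r}_{\mathrm{Pl}}(n,p)\le \frac{3}{8}n$ for all $n\ge N_0(p)$, where $N_0(p)$ is the larger of the two solutions $n$ of $\widetilde{r}_{\mathrm{Pl}}(n,p)=\frac{3}{8}n$; and 2. $\widetilde{r}_{\mathrm{Pl}}(n,p)\ge \frac{3}{8}n+2$ precisely for $n\in[\,n_{-}(p),\,n_+(p)\,]$, where $0<n_{-}(p)<13<n_+(p)$ are the two solutions $n$ of $\widetilde{r}_{\mathrm{Pl}}(n,p)=\frac{3}{8}n+2$. *)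

theory Defs
  imports Complex_Main "HOL-Computational_Algebra.Primes"
begin

text \<open>
  Only meaningful for \<open>n > 0\<close>: outside that range \<^const>\<open>log\<close> takes junk values,
  so solutions in \<open>n\<close> must be restricted to positive reals explicitly.
\<close>

definition r_Pl :: "real \<Rightarrow> nat \<Rightarrow> real" where
  "r_Pl n p = (3 * real p - 4) / (8 * (real p - 1)) * n + log (real p) n
     + log (real p) (real p ^ 3 / 8)"

end

theory Submission
  imports Defs
begin

text \<open>
  Since \<open>(3p - 4) / (8(p - 1)) = 3/8 - 1 / (8(p - 1))\<close>, multiplying by \<open>ln p > 0\<close> turns the
  difference of \<^term>\<open>r_Pl n p\<close> and \<open>3/8 n + k\<close> into
  \<open>ln n + c - a n\<close> with \<open>a = ln p / (8(p - 1)) > 0\<close> and \<open>c = (3 - k) ln p - ln 8\<close>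
  (lemma \<open>r_Pl_minus_line\<close>). Such a function rises strictly up to \<open>1/a\<close>, falls strictly after it,
  and is negative near \<open>0\<close> and near infinity. Hence, as soon as it is positive at a single
  point \<open>t\<close>, it has exactly two zeros, one on either side of \<open>t\<close>, and is nonnegative precisely
  between them (lemma \<open>ln_minus_linear_two_zeros\<close>). Both parts of the theorem are the
  cases \<open>k = 0\<close> and \<open>k = 2\<close> with \<open>t = 13\<close>. The value at \<open>13\<close> decreases in \<open>k\<close>, and for \<open>k = 2\<close>
  it is \<open>ln (13/8) + (1 - 13 / (8(p - 1))) ln p\<close>, whose summands are
  both positive because \<open>8(p - 1) \<ge> 16 > 13\<close>.
\<close>

text \<open>
  The monotonicity below comes from \<open>ln u < u - 1\<close> for \<open>u \<noteq> 1\<close>, applied to \<open>u = x/y\<close> on the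
  rising side and to \<open>u = y/x\<close> on the falling side.
\<close>

lemma ln_minus_linear_strict_increasing:
  fixes a x y :: real
  assumes "a > 0" "0 < x" "x < y" "y \<le> 1 / a"
  shows "ln x - a * x < ln y - a * y"
proof -
  have "ln (x / y) < x / y - 1"
    using assms ln_le_minus_one[of "x / y"] ln_eq_minus_one[of "x / y"] by fastforce
  moreover have "a * (y - x) \<le> 1 - x / y"
  proof -
    have "a * y * (y - x) \<le> 1 * (y - x)"
      using assms by (intro mult_right_mono) (auto simp: field_simps)
    then show ?thesis using assms by (simp add: field_simps)
  qed
  ultimately show ?thesis
    using assms by (simp add: ln_div algebra_simps)
qed

lemma ln_minus_linear_strict_decreasing:
  fixes a x y :: real
  assumes "a > 0" "1 / a \<le> x" "x < y"
  shows "ln y - a * y < ln x - a * x"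
proof -
  have "0 < 1 / a" using assms by simp
  then have x: "0 < x" using assms by linarith
  have "ln (y / x) < y / x - 1"
    using assms x ln_le_minus_one[of "y / x"] ln_eq_minus_one[of "y / x"] by fastforce
  moreover have "y / x - 1 \<le> a * (y - x)"
  proof -
    have "1 * (y - x) \<le> a * x * (y - x)"
      using assms by (intro mult_right_mono) (auto simp: field_simps)
    then show ?thesis using x by (simp add: field_simps)
  qed
  ultimately show ?thesis
    using assms x by (simp add: ln_div algebra_simps)
qed

lemma ln_minus_linear_two_zeros:
  fixes a c t :: real
  defines "g \<equiv> \<lambda>x. ln x + c - a * x"
  assumes a: "a > 0" and t: "t > 0" and gt: "g t > 0"
  obtains m M where "0 < m" "m < t" "t < M"
    and "{x. x > 0 \<and> g x = 0} = {m, M}"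
    and "\<And>x. x > 0 \<Longrightarrow> g x \<ge> 0 \<longleftrightarrow> x \<in> {m..M}"
proof -
  define s where "s = 1 / a"
  have s: "s > 0" using a by (simp add: s_def)
  have up: "g x < g y" if "0 < x" "x < y" "y \<le> s" for x y
    using ln_minus_linear_strict_increasing[of a x y] that a by (simp add: g_def s_def)
  have down: "g y < g x" if "s \<le> x" "x < y" for x y
    using ln_minus_linear_strict_decreasing[of a x y] that a by (simp add: g_def s_def)
  have gs: "g s > 0"
    using up[of t s] down[of s t] gt t by fastforce
  have cont: "continuous_on {u..v} g" if "u > 0" for u v
    unfolding g_def using that by (intro continuous_intros) auto
  \<comment> \<open>At \<open>exp (- c)\<close> the logarithm cancels \<open>c\<close>; this point lies left of the peak
    because \<open>ln s + c > a s = 1\<close>.\<close>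
  obtain m where m: "0 < m" "m < s" "g m = 0"
  proof -
    define l where "l = exp (- c)"
    have l: "0 < l" "g l < 0" using a by (simp_all add: l_def g_def)
    have "- c < ln s" using gs a by (simp add: g_def s_def)
    then have "exp (- c) < exp (ln s)" by (simp only: exp_less_cancel_iff)
    then have ls: "l < s" using s by (simp add: l_def)
    obtain m where "l \<le> m" "m \<le> s" "g m = 0"
      using IVT'[of g l 0 s] l ls gs cont[of l s] by auto
    moreover from this have "m \<noteq> s" using gs by auto
    ultimately show thesis using l by (intro that[of m]) auto
  qed
  obtain M where M: "s < M" "g M = 0"
  proof -
    \<comment> \<open>The tangent of \<open>ln\<close> at \<open>2 s\<close> has slope \<open>a/2\<close>, so \<open>g\<close> lies below a line of slope \<open>-a/2\<close>;
      \<open>r\<close> is chosen far enough for that line to be negative.\<close>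
    define d where "d = \<bar>ln (2 * s) + c\<bar>"
    define r where "r = s + 2 * s * d"
    have d: "d \<ge> 0" "ln (2 * s) + c \<le> d" by (simp_all add: d_def)
    have sr: "s \<le> r" using s d by (simp add: r_def)
    have "ln r - ln (2 * s) \<le> r / (2 * s) - 1"
      using ln_le_minus_one[of "r / (2 * s)"] s sr by (simp add: ln_div)
    moreover have "r / (2 * s) = 1 / 2 + d"
      using s by (simp add: r_def field_simps)
    moreover have "a * r = 1 + 2 * d"
      using a by (simp add: r_def s_def field_simps)
    ultimately have "g r < 0" unfolding g_def using d by simp
    note r = sr this
    obtain M where "s \<le> M" "M \<le> r" "g M = 0"
      using IVT2'[of g r 0 s] r gs cont[of s r] s by auto
    moreover from this have "M \<noteq> s" using gs by auto
    ultimately show thesis by (intro that[of M]) auto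
  qed
  have sign: "(g x \<ge> 0 \<longleftrightarrow> x \<in> {m..M}) \<and> (g x = 0 \<longleftrightarrow> x = m \<or> x = M)" if "x > 0" for x
  proof (cases "x \<le> s")
    case True
    then show ?thesis
      using up[of x m] up[of m x] m M that by (cases x m rule: linorder_cases) auto
  next
    case False
    then show ?thesis
      using down[of x M] down[of M x] m M that by (cases x M rule: linorder_cases) auto
  qed
  show thesis
  proof (rule that[of m M])
    show "m < t" "t < M" using sign[OF t] gt by force+
    show "{x. x > 0 \<and> g x = 0} = {m, M}" using sign m M by fastforce
  qed (use sign m in auto)
qed

lemma r_Pl_minus_line:
  assumes "p \<ge> 3" "n > 0"
  shows "ln (real p) * (r_Pl n p - (3 / 8 * n + k)) =
    ln n + ((3 - k) * ln (real p) - ln 8) - ln (real p) / (8 * (real p - 1)) * n"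
proof -
  have p: "real p \<ge> 3" "ln (real p) > 0" using assms by auto
  have "(3 * real p - 4) / (8 * (real p - 1)) = 3 / 8 - 1 / (8 * (real p - 1))"
    using p by (simp add: field_simps)
  then have gap: "r_Pl n p - (3 / 8 * n + k) =
      ln n / ln (real p) + (3 * ln (real p) - ln 8) / ln (real p) - k - n / (8 * (real p - 1))"
    unfolding r_Pl_def \<open>(3 * real p - 4) / _ = _\<close>
    using p by (simp add: log_def ln_div ln_realpow left_diff_distrib)
  have scale: "L * (u / L + v / L - k - w) = u + v - k * L - w * L" if "L > 0" for L u v w :: real
    using that by (simp add: field_simps)
  show ?thesis
    unfolding gap scale[OF p(2)] by (simp add: algebra_simps)
qed

lemma r_Pl_two_solutions:
  fixes k :: real
  assumes p: "p \<ge> 3" and k: "k \<le> 2"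
  obtains m M where "0 < m" "m < 13" "13 < M"
    and "{n. n > 0 \<and> r_Pl n p = 3 / 8 * n + k} = {m, M}"
    and "\<And>n. n > 0 \<Longrightarrow> r_Pl n p \<ge> 3 / 8 * n + k \<longleftrightarrow> n \<in> {m..M}"
proof -
  define L where "L = ln (real p)"
  define a where "a = L / (8 * (real p - 1))"
  define c where "c = (3 - k) * L - ln 8"
  have L: "L > 0" using p by (simp add: L_def)
  have a: "a > 0" using L p by (simp add: a_def)
  have gap: "L * (r_Pl n p - (3 / 8 * n + k)) = ln n + c - a * n" if "n > 0" for n
    using r_Pl_minus_line[OF p that, of k] by (simp add: L_def a_def c_def)
  have pos13: "ln 13 + c - a * 13 > 0"
  proof -
    have "a \<le> L / 16"
      unfolding a_def using L p by (intro divide_left_mono) auto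
    moreover have "ln 8 < ln (13 :: real)" by simp
    moreover have "1 * L \<le> (3 - k) * L" using k L by (intro mult_right_mono) auto
    ultimately show ?thesis using L unfolding c_def by linarith
  qed
  obtain m M where mM: "0 < m" "m < 13" "13 < M"
    and zeros: "{n. n > 0 \<and> ln n + c - a * n = 0} = {m, M}"
    and sign: "\<And>n. n > 0 \<Longrightarrow> ln n + c - a * n \<ge> 0 \<longleftrightarrow> n \<in> {m..M}"
    using ln_minus_linear_two_zeros[OF a _ pos13] by auto
  have eq: "r_Pl n p = 3 / 8 * n + k \<longleftrightarrow> ln n + c - a * n = 0" if "n > 0" for n
    using gap[OF that, symmetric] L by simp
  have ge: "r_Pl n p \<ge> 3 / 8 * n + k \<longleftrightarrow> ln n + c - a * n \<ge> 0" if "n > 0" for n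
    using gap[OF that, symmetric] L by (simp add: zero_le_mult_iff)
  show thesis
  proof (rule that[OF mM])
    show "{n. n > 0 \<and> r_Pl n p = 3 / 8 * n + k} = {m, M}"
      using zeros eq by auto
  qed (use ge sign in simp)
qed

theorem proposition2p16:
  fixes p :: nat
  assumes "prime p" and "p \<ge> 3"
  shows "(\<exists>m N\<^sub>0 :: real. 0 < m \<and> m < N\<^sub>0 \<and>
            {n. n > 0 \<and> r_Pl n p = 3 / 8 * n} = {m, N\<^sub>0} \<and>
            (\<forall>n\<ge>N\<^sub>0. r_Pl n p \<le> 3 / 8 * n)) \<and>
         (\<exists>n_minus n_plus :: real. 0 < n_minus \<and> n_minus < 13 \<and> 13 < n_plus \<and>
            {n. n > 0 \<and> r_Pl n p = 3 / 8 * n + 2} = {n_minus, n_plus} \<and>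
            (\<forall>n>0. r_Pl n p \<ge> 3 / 8 * n + 2 \<longleftrightarrow> n \<in> {n_minus..n_plus}))"
proof (rule conjI, goal_cases)
  case 1
  obtain m M where mM: "0 < m" "m < 13" "13 < M"
    and zeros: "{n. n > 0 \<and> r_Pl n p = 3 / 8 * n + 0} = {m, M}"
    and sign: "\<And>n. n > 0 \<Longrightarrow> r_Pl n p \<ge> 3 / 8 * n + 0 \<longleftrightarrow> n \<in> {m..M}"
    using r_Pl_two_solutions[OF assms(2), of 0] by auto
  have "r_Pl n p \<le> 3 / 8 * n" if "n \<ge> M" for n
  proof (cases "n = M")
    case True
    moreover have "M \<in> {n. n > 0 \<and> r_Pl n p = 3 / 8 * n + 0}" unfolding zeros by simp
    ultimately show ?thesis by simp
  next
    case False
    then have "\<not> r_Pl n p \<ge> 3 / 8 * n + 0" using sign[of n] that mM by simp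
    then show ?thesis by simp
  qed
  moreover have "m < M" using mM by simp
  ultimately show ?case using mM(1) zeros unfolding add_0_right by blast
next
  case 2
  show ?case by (rule r_Pl_two_solutions[OF assms(2), of 2]) (simp, blast)
qed

end
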